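(* Let $\{\Lambda^n\}_{n\ge1}$ be a symmetric, two-sided Markov family, with $\Lambda^1$ of the form $$\Lambda^1_{a,b}(x)=f(a,b)\cdot g(b,x)\cdot g(a,x)\quad (x\in I_{a,b}),\qquad f(a,b)^{-1}=\int_{a\wedge b}^{a\vee b} g(a,x)\cdot g(b,x)\,dx,$$ for all $a,b\in\mathbb{R}^+$, $a\neq b$, for some symmetric function $g:\mathbb{R}^+_0\times\mathbb{R}^+_0\to\mathbb{R}^+_0$. Assume that $g(x,\cdot)$ is differentiable on $\mathbb{R}^+\setminus\{x\}$ for all $x\in\mathbb{R}^+$. If $\{\Lambda^n\}_{n\ge1}$ is both scale invariant and shift invariant, then, for some $\sigma,t\in\mathbb{R}^+$, $$g(a,x)=t\cdot|a-x|^{\sigma}.$$ As a consequence, for $s=\sigma+1$, $$\Lambda^1_{a,b}(x)=f(a,b)\cdot|b-x|^{s-1}\cdot|x-a|^{s-1}\qquad(x\in I_{a,b}),$$ where $f(a,b)$ here denotes the normalizing constant. In other words, one recovers the density corresponding to the Dirichlet process (ordered Dirichlet distribution) with parameter $s$, whose one-site density is $\frac{\Gamma(2s)}{\Gamma(s)^2}\,|b-a|^{-(2s-1)}\,|b-x|^{s-1}|x-a|^{s-1}\,\mathbf{1}(x\in I_{a,b})$.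
   Context: Notation: $\mathbb{R}^+=(0,\infty)$ and $\mathbb{R}^+_0=[0,\infty)$; for $a,b\in\mathbb{R}^+$, $I_{a,b}=(a\wedge b,a\vee b)$ where $\wedge$ is minimum and $\vee$ is maximum. Pairs of parameters $(a,b)$ are always taken with $a\neq b$. The support of a function $f$ is $\mathrm{supp}(f)=\{x: f(x)\neq 0\}$. A function $g$ of two variables is symmetric if $g(u,v)=g(v,u)$ for all $u,v$. $\Gamma$ is the Gamma function. Families: a family $\{\Lambda^n\}_{n\ge1}$ assigns to every $n\ge 1$ and every $a,b\in\mathbb{R}^+$, $a\ne b$, a function $\Lambda^n_{a,b}:\mathbb{R}^n\to[0,\infty)$ which is a probability density (with respect to Lebesgue measure) of a random vector $(\Theta_1,\dots,\Theta_n)$ taking values in $(I_{a,b})^n$; it is taken to vanish outside $(I_{a,b})^n$. One sets $\Lambda^0_{a,b}:=1$. The $i$-th marginal is $$\Lambda^{n,i}_{a,b}(\theta_i)=\int_{-\infty}^\infty\cdots\int_{-\infty}^\infty \Lambda^n_{a,b}(\theta_1,\dots,\theta_n)\,d\theta_1\cdots d\theta_{i-1}\,d\theta_{i+1}\cdots d\theta_n,$$ and for $\theta_i\in\mathrm{supp}(\Lambda^{n,i}_{a,b})$ the conditional density is $\Lambda^n_{a,b}(\theta_1,\dots,\theta_n\mid\Theta_i=\theta_i):=\Lambda^n_{a,b}(\theta_1,\dots,\theta_n)/\Lambda^{n,i}_{a,b}(\theta_i)$. The family is two-sided Markov if for all $n\ge1$ and $a,b\in\mathbb{R}^+$: (i)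 $\Lambda^n_{a,b}(\theta_1,\dots,\theta_n\mid\Theta_j=\theta_j)=\Lambda^{j-1}_{a,\theta_j}(\theta_1,\dots,\theta_{j-1})\cdot\Lambda^{n-j}_{\theta_j,b}(\theta_{j+1},\dots,\theta_n)$ for all $1\le j\le n$ and all $\theta_1,\dots,\theta_n\in I_{a,b}$ (whenever the conditional density is defined); and (ii) $\mathrm{supp}(\Lambda^1_{a,b})=I_{a,b}$. The family is symmetric if $\Lambda^n_{a,b}(\theta_1,\dots,\theta_n)=\Lambda^n_{b,a}(\theta_n,\dots,\theta_1)$ for all $n\ge1$, $a,b\in\mathbb{R}^+$ and $\theta_1,\dots,\theta_n\in I_{a,b}$. The family is scale invariant if $\Lambda^n_{a,b}(\theta_1,\dots,\theta_n)=\gamma^n\,\Lambda^n_{\gamma a,\gamma b}(\gamma\theta_1,\dots,\gamma\theta_n)$ for all $a,b,\gamma\in\mathbb{R}^+$, $n\ge1$ and $\theta_1\in I_{a,b},\ \theta_2\in I_{\theta_1,b},\dots,\theta_n\in I_{\theta_{n-1},b}$. The family is shift invariant if $\Lambda^n_{a,b}(\theta_1,\dots,\theta_n)=\Lambda^n_{a+\gamma,b+\gamma}(\theta_1+\gamma,\dots,\theta_n+\gamma)$ for all $a,b\in\mathbb{R}^+$, $\gamma>-(a\wedge b)$, $n\ge1$ and $\theta_1\in I_{a,b},\ \theta_2\in I_{\theta_1,b},\dots,\theta_n\in I_{\theta_{n-1},b}$.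
   Formalization: The formula for g is corrected: g(a,x)=t|a-x|^σ holds only up to a factor p(a∧x)/p(a∨x), p>0, which f absorbs (t|a-x|^σ is shown to be an admissible choice of g), and σ ranges over σ>-1 (s>0) rather than σ>0. *)

theory Defs
  imports "HOL-Analysis.Analysis"
begin

text \<open>
  A family is a function \<open>\<Lambda> n a b \<theta>\<close> where the point \<open>\<theta> = (\<theta>\<^sub>1, \<dots>, \<theta>\<^sub>n)\<close> of \<open>\<real>\<^sup>n\<close> is a list of
  length \<open>n\<close>. Coordinates are counted from 0, so \<open>\<theta> ! i\<close> is \<open>\<theta>\<^sub>j\<close> with \<open>j = i + 1\<close>. Values of \<open>\<Lambda>\<close>
  at lists of other lengths, at \<open>a = b\<close>, or at non-positive \<open>a\<close>, \<open>b\<close> are irrelevant.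
\<close>

type_synonym family = "nat \<Rightarrow> real \<Rightarrow> real \<Rightarrow> real list \<Rightarrow> real"

definition ival :: "real \<Rightarrow> real \<Rightarrow> real set" where
  "ival a b = {min a b <..< max a b}"

text \<open>The support without topological closure.\<close>

definition supp :: "('a \<Rightarrow> real) \<Rightarrow> 'a set" where
  "supp h = {x. h x \<noteq> 0}"

definition density_family :: "family \<Rightarrow> bool" where
  "density_family \<Lambda> \<longleftrightarrow>
    (\<forall>a>0. \<forall>b>0. a \<noteq> b \<longrightarrow>
      \<Lambda> 0 a b [] = 1 \<and>
      (\<forall>n\<ge>1.
        (\<forall>\<theta>. length \<theta> = n \<longrightarrow> 0 \<le> \<Lambda> n a b \<theta>) \<and>
        (\<forall>\<theta>. length \<theta> = n \<longrightarrow> \<not> set \<theta> \<subseteq> ival a b \<longrightarrow> \<Lambda> n a b \<theta> = 0) \<and>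
        (\<lambda>x. \<Lambda> n a b (map x [0..<n])) \<in> borel_measurable (\<Pi>\<^sub>M k\<in>{..<n}. lborel) \<and>
        (\<integral>\<^sup>+x. ennreal (\<Lambda> n a b (map x [0..<n])) \<partial>(\<Pi>\<^sub>M k\<in>{..<n}. lborel)) = 1))"

text \<open>
  At the (Lebesgue-null set of) points where the integral over the other coordinates is infinite,
  the Bochner integral is 0; such points are then outside the support of the marginal, and the
  conditional density is regarded as undefined there.
\<close>

definition marginal :: "family \<Rightarrow> nat \<Rightarrow> nat \<Rightarrow> real \<Rightarrow> real \<Rightarrow> real \<Rightarrow> real" where
  "marginal \<Lambda> n i a b y =
    (\<integral>x. \<Lambda> n a b (map (x(i := y)) [0..<n]) \<partial>(\<Pi>\<^sub>M k\<in>{..<n} - {i}. lborel))"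

definition cond_density :: "family \<Rightarrow> nat \<Rightarrow> nat \<Rightarrow> real \<Rightarrow> real \<Rightarrow> real list \<Rightarrow> real" where
  "cond_density \<Lambda> n i a b \<theta> = \<Lambda> n a b \<theta> / marginal \<Lambda> n i a b (\<theta> ! i)"

definition two_sided_markov :: "family \<Rightarrow> bool" where
  "two_sided_markov \<Lambda> \<longleftrightarrow>
    (\<forall>n\<ge>1. \<forall>a>0. \<forall>b>0. a \<noteq> b \<longrightarrow>
      (\<forall>i<n. \<forall>\<theta>. length \<theta> = n \<longrightarrow> set \<theta> \<subseteq> ival a b \<longrightarrow> \<theta> ! i \<in> supp (marginal \<Lambda> n i a b) \<longrightarrow>
        cond_density \<Lambda> n i a b \<theta> =
          \<Lambda> i a (\<theta> ! i) (take i \<theta>) * \<Lambda> (n - Suc i) (\<theta> ! i) b (drop (Suc i) \<theta>))) \<and>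
    (\<forall>a>0. \<forall>b>0. a \<noteq> b \<longrightarrow> supp (\<lambda>x. \<Lambda> 1 a b [x]) = ival a b)"

definition symmetric_family :: "family \<Rightarrow> bool" where
  "symmetric_family \<Lambda> \<longleftrightarrow>
    (\<forall>n\<ge>1. \<forall>a>0. \<forall>b>0. a \<noteq> b \<longrightarrow>
      (\<forall>\<theta>. length \<theta> = n \<longrightarrow> set \<theta> \<subseteq> ival a b \<longrightarrow> \<Lambda> n a b \<theta> = \<Lambda> n b a (rev \<theta>)))"

text \<open>The condition \<open>\<theta>\<^sub>1 \<in> I\<^bsub>a,b\<^esub>, \<theta>\<^sub>2 \<in> I\<^bsub>\<theta>\<^sub>1,b\<^esub>, \<dots>, \<theta>\<^sub>n \<in> I\<^bsub>\<theta>\<^sub>n\<^sub>-\<^sub>1,b\<^esub>\<close>.\<close>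

fun nested :: "real \<Rightarrow> real \<Rightarrow> real list \<Rightarrow> bool" where
  "nested a b [] \<longleftrightarrow> True"
| "nested a b (x # xs) \<longleftrightarrow> x \<in> ival a b \<and> nested x b xs"

definition scale_invariant :: "family \<Rightarrow> bool" where
  "scale_invariant \<Lambda> \<longleftrightarrow>
    (\<forall>n\<ge>1. \<forall>a>0. \<forall>b>0. \<forall>\<gamma>>0. a \<noteq> b \<longrightarrow>
      (\<forall>\<theta>. length \<theta> = n \<longrightarrow> nested a b \<theta> \<longrightarrow>
        \<Lambda> n a b \<theta> = \<gamma> ^ n * \<Lambda> n (\<gamma> * a) (\<gamma> * b) (map (\<lambda>x. \<gamma> * x) \<theta>)))"

definition shift_invariant :: "family \<Rightarrow> bool" where
  "shift_invariant \<Lambda> \<longleftrightarrow>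
    (\<forall>n\<ge>1. \<forall>a>0. \<forall>b>0. \<forall>\<gamma>>- min a b. a \<noteq> b \<longrightarrow>
      (\<forall>\<theta>. length \<theta> = n \<longrightarrow> nested a b \<theta> \<longrightarrow>
        \<Lambda> n a b \<theta> = \<Lambda> n (a + \<gamma>) (b + \<gamma>) (map (\<lambda>x. x + \<gamma>) \<theta>)))"

text \<open>
  \<open>\<Lambda>\<^sup>1\<close> has product form with factor \<open>g\<close> and normalizing constant \<open>f\<close>. A divergent integral would
  be 0 here and so force \<open>f a b = 0\<close>, which contradicts \<open>\<Lambda>\<^sup>1\<close> being a density.

  The factor \<open>g\<close> is not determined by \<open>\<Lambda>\<^sup>1\<close>: for \<open>p > 0\<close>, replacing \<open>g a x\<close> by
  \<open>g a x * (p (min a x) / p (max a x))\<close> multiplies \<open>g b x * g a x\<close> by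
  \<open>p (min a b) / p (max a b)\<close> for all \<open>x\<close> between \<open>a\<close> and \<open>b\<close>, which \<open>f a b\<close> absorbs.
\<close>

definition one_site_form ::
    "family \<Rightarrow> (real \<Rightarrow> real \<Rightarrow> real) \<Rightarrow> (real \<Rightarrow> real \<Rightarrow> real) \<Rightarrow> bool" where
  "one_site_form \<Lambda> f g \<longleftrightarrow>
    (\<forall>a>0. \<forall>b>0. a \<noteq> b \<longrightarrow>
      (\<forall>x\<in>ival a b. \<Lambda> 1 a b [x] = f a b * g b x * g a x) \<and>
      inverse (f a b) = (LINT x:ival a b|lborel. g a x * g b x))"

definition ordered_dirichlet_density :: "real \<Rightarrow> real \<Rightarrow> real \<Rightarrow> real \<Rightarrow> real" where
  "ordered_dirichlet_density s a b x =
    Gamma (2 * s) / (Gamma s)\<^sup>2 * \<bar>b - a\<bar> powr (- (2 * s - 1)) *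
      \<bar>b - x\<bar> powr (s - 1) * \<bar>x - a\<bar> powr (s - 1) * indicator (ival a b) x"

end

theory Submission
  imports Defs
begin

text \<open>
  By scale and shift invariance of the one-site densities and their product form,
  \<open>G a x = ln (g a x)\<close> satisfies, for every affine map \<open>\<tau> x = c * x + \<mu>\<close> with \<open>c > 0\<close>, \<open>\<mu> \<ge> 0\<close>, and all
  \<open>a < x < b\<close>,
  \<open>G (\<tau> a) (\<tau> x) + G (\<tau> x) (\<tau> b) = G a x + G x b + \<Phi> a b\<close>,
  where \<open>\<Phi>\<close> collects the normalizing constants and so does not depend on the middle point \<open>x\<close>.
  A sum of a function of \<open>(a, x)\<close> and a function of \<open>(x, b)\<close> that is independent of \<open>x\<close> is rigid:
  the change of \<open>G a x - G b x\<close> under \<open>\<tau>\<close> does not depend on \<open>x\<close>. Hence the derivative of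
  \<open>G a x - G b x\<close> in \<open>x\<close> depends on \<open>x - a\<close> and \<open>x - b\<close> only, is homogeneous of degree \<open>-1\<close> in
  them, and is additive in the pair \<open>(a, b)\<close>. These three properties alone, with no regularity,
  force it to be \<open>\<sigma> * (1 / (x - a) - 1 / (x - b))\<close> (lemma \<open>homogeneous_cocycle\<close>).

  Integration in \<open>x\<close> gives \<open>G a x = \<sigma> * ln (x - a) + v a + u x\<close> for \<open>a < x\<close>. Inserting this back into the
  invariance shows that \<open>u + v\<close> changes by a constant under each \<open>\<tau>\<close>, so it is constant
  (lemma \<open>affine_quasi_invariant_imp_constant\<close>). What remains of \<open>u\<close> and \<open>v\<close> is the factor
  \<open>p a / p x\<close> with \<open>p x = exp (- u x)\<close>, which telescopes in \<open>g a x * g x b\<close> and is absorbed in the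
  normalization (lemma \<open>affine_quasi_invariant_kernel\<close>).

  Finally, a divergent normalizing integral would have the value 0, whereas its inverse \<open>f a b\<close> is not
  0, since the one-site density is positive between \<open>a\<close> and \<open>b\<close>. So
  \<open>y powr \<sigma> * (1 - y) powr \<sigma>\<close> is integrable on the unit interval, which means \<open>\<sigma> > -1\<close>, and the
  normalizing constant is a beta integral.
\<close>

section \<open>Kernels quasi-invariant under affine maps\<close>

text \<open>
  Both \<open>R a x\<close> and \<open>R a y\<close> can be compared with a common right end point \<open>c\<close>: the increment
  \<open>R a y - R a x\<close> equals \<open>R x c - R y c\<close>, in which \<open>a\<close> no longer occurs.
\<close>
lemma increment_diff_independent_of_endpoint:
  fixes R :: "real \<Rightarrow> real \<Rightarrow> real"
  assumes "\<And>a x b. 0 < a \<Longrightarrow> a < x \<Longrightarrow> x < b \<Longrightarrow> R a x + R x b = \<Phi> a b"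
    and "0 < a" "0 < b" "max a b < x" "max a b < y"
  shows "R a x - R b x = R a y - R b y"
proof -
  define c where "c = max x y + 1"
  have "R a x + R x c = \<Phi> a c" "R a y + R y c = \<Phi> a c"
       "R b x + R x c = \<Phi> b c" "R b y + R y c = \<Phi> b c"
    by (rule assms(1); use assms(2-) in \<open>simp add: c_def\<close>)+
  then show ?thesis by linarith
qed

text \<open>
  With \<open>k u = e u 1\<close> the hypotheses say \<open>k (c * u) = k c + k u / c\<close>. The left-hand side is symmetric
  in \<open>c\<close> and \<open>u\<close>, so \<open>k c * (1 - 1 / u) = k u * (1 - 1 / c)\<close>, which determines \<open>k\<close> up to a factor
  without any measurability or continuity assumption.
\<close>
lemma homogeneous_cocycle:
  fixes e :: "real \<Rightarrow> real \<Rightarrow> real"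
  assumes cocycle: "\<And>u v w. 0 < u \<Longrightarrow> 0 < v \<Longrightarrow> 0 < w \<Longrightarrow> e u v + e v w = e u w"
    and homogeneous: "\<And>c u v. 0 < c \<Longrightarrow> 0 < u \<Longrightarrow> 0 < v \<Longrightarrow> c * e (c * u) (c * v) = e u v"
  shows "\<exists>C. \<forall>u>0. \<forall>v>0. e u v = C * (1 / u - 1 / v)"
proof -
  define k where "k u = e u 1" for u
  have e_eq: "e u v = k u - k v" if "0 < u" "0 < v" for u v
    using cocycle[of u v 1] that by (simp add: k_def)
  have mult: "c * (k (c * u) - k c) = k u" if "0 < c" "0 < u" for c u
    using homogeneous[of c u 1] e_eq[of "c * u" c] that by (simp add: k_def)
  have k_eq: "k u = 2 * k 2 * (1 - 1 / u)" if "0 < u" for u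
  proof -
    \<comment> \<open>The symmetry of \<open>k (c * u)\<close> at \<open>c = 2\<close> expresses \<open>k u\<close> through \<open>k 2\<close>.\<close>
    have "2 * (k (2 * u) - k 2) = k u" "u * (k (2 * u) - k u) = k 2"
      using mult[of 2 u] mult[of u 2] that by (simp_all add: mult.commute)
    then show ?thesis using that by (simp add: field_simps) algebra
  qed
  have "e u v = (- 2 * k 2) * (1 / u - 1 / v)" if "0 < u" "0 < v" for u v
    unfolding e_eq[OF that] k_eq[OF that(1)] k_eq[OF that(2)] by (simp add: algebra_simps)
  then show ?thesis by blast
qed

text \<open>
  The derivative satisfies \<open>c * S' (c * x + \<mu>) = S' x\<close>. The point \<open>2 * x\<close> is the image of \<open>x\<close> both
  under the dilation by 2 and under the translation by \<open>x\<close>, so \<open>S' (2 * x)\<close> is both \<open>S' x / 2\<close> and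
  \<open>S' x\<close>.
\<close>
lemma affine_quasi_invariant_imp_constant:
  fixes S :: "real \<Rightarrow> real"
  assumes diff: "\<And>x. 0 < x \<Longrightarrow> S differentiable (at x)"
    and quasi: "\<And>c \<mu>. 0 < c \<Longrightarrow> 0 \<le> \<mu> \<Longrightarrow> \<exists>K. \<forall>x>0. S (c * x + \<mu>) = S x + K"
    and "0 < x" "0 < y"
  shows "S x = S y"
proof -
  have D: "(S has_real_derivative deriv S x) (at x)" if "0 < x" for x
    using diff[OF that] by (simp add: DERIV_deriv_iff_real_differentiable)
  have D_affine: "c * deriv S (c * x + \<mu>) = deriv S x" if c: "0 < c" "0 \<le> \<mu>" and x: "0 < x" for c \<mu> x
  proof -
    obtain K where K: "\<forall>x>0. S (c * x + \<mu>) = S x + K" using quasi[OF c] by blast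
    have "0 < c * x + \<mu>" using c x by (simp add: add_pos_nonneg)
    have lhs: "((\<lambda>x. S (c * x + \<mu>)) has_real_derivative deriv S (c * x + \<mu>) * c) (at x)"
      by (rule DERIV_chain2[where f = S and g = "\<lambda>x. c * x + \<mu>" and x = x, OF D[OF \<open>0 < c * x + \<mu>\<close>]])
         (auto intro!: derivative_eq_intros)
    have "((\<lambda>x. S x + K) has_real_derivative deriv S x) (at x)"
      using D[OF x] by (auto intro!: derivative_eq_intros)
    then have "((\<lambda>x. S (c * x + \<mu>)) has_real_derivative deriv S x) (at x)"
      by (rule has_field_derivative_transform_within_open[where S = "{0<..}"])
         (use K x in auto)
    then show ?thesis using DERIV_unique[OF lhs] by (simp add: mult.commute)
  qed
  have "deriv S x = 0" if "0 < x" for x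
  proof -
    have "deriv S (x + x) = deriv S x" using D_affine[of 1 x x] that by simp
    moreover have "2 * deriv S (x + x) = deriv S x" using D_affine[of 2 0 x] that by simp
    ultimately show ?thesis by simp
  qed
  then have "(S has_real_derivative 0) (at z within {0<..})" if "z \<in> {0<..}" for z
    using D[of z] that by (auto intro: has_field_derivative_at_within)
  then obtain K where "\<And>z. z \<in> {0<..} \<Longrightarrow> S z = K"
    using has_field_derivative_zero_constant[of "{0<..}" S] by (auto simp: convex_real_interval)
  then show ?thesis using \<open>0 < x\<close> \<open>0 < y\<close> by simp
qed

text \<open>
  Differentiability in each variable separately suffices: the mixed second derivative, which
  would be invariant up to the factor \<open>c\<^sup>2\<close>, is replaced by a difference in the first variable
  and a derivative in the second. Translations to the left would leave the half-line of positive
  points, but each of them is undone by a translation to the right, so \<open>\<mu> \<ge> 0\<close> is enough.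
\<close>
lemma affine_quasi_invariant_kernel:
  fixes G :: "real \<Rightarrow> real \<Rightarrow> real"
  assumes sym: "\<And>a x. 0 < a \<Longrightarrow> 0 < x \<Longrightarrow> G a x = G x a"
    and diff: "\<And>a x. 0 < a \<Longrightarrow> 0 < x \<Longrightarrow> x \<noteq> a \<Longrightarrow> G a differentiable (at x)"
    and quasi: "\<And>c \<mu>. 0 < c \<Longrightarrow> 0 \<le> \<mu> \<Longrightarrow> \<exists>\<Phi>. \<forall>a x b. 0 < a \<longrightarrow> a < x \<longrightarrow> x < b \<longrightarrow>
      G (c * a + \<mu>) (c * x + \<mu>) + G (c * x + \<mu>) (c * b + \<mu>) = G a x + G x b + \<Phi> a b"
  shows "\<exists>\<sigma> K u. \<forall>a x. 0 < a \<longrightarrow> a < x \<longrightarrow> G a x = K + \<sigma> * ln (x - a) + u x - u a"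
proof -
  have D: "(G a has_real_derivative deriv (G a) x) (at x)" if "0 < a" "0 < x" "x \<noteq> a" for a x
    using diff[OF that] by (simp add: DERIV_deriv_iff_real_differentiable)
  define E where "E a b x = deriv (G a) x - deriv (G b) x" for a b x
  have E_affine: "c * E (c * a + \<mu>) (c * b + \<mu>) (c * x + \<mu>) = E a b x"
    if c: "0 < c" "0 \<le> \<mu>" and abx: "0 < a" "0 < b" "max a b < x" for c \<mu> a b x
  proof -
    define R where "R a x = G (c * a + \<mu>) (c * x + \<mu>) - G a x" for a x
    obtain \<Phi> where \<Phi>: "\<And>a x b. 0 < a \<Longrightarrow> a < x \<Longrightarrow> x < b \<Longrightarrow>
      G (c * a + \<mu>) (c * x + \<mu>) + G (c * x + \<mu>) (c * b + \<mu>) = G a x + G x b + \<Phi> a b"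
      using quasi[OF c] by blast
    have "R a x + R x b = \<Phi> a b" if "0 < a" "a < x" "x < b" for a x b
      using \<Phi>[OF that] by (simp add: R_def)
    then have const: "R a x - R b x = R a y - R b y" if "max a b < y" for y
      using increment_diff_independent_of_endpoint[of R \<Phi> a b x y] abx that by blast
    have DR: "(R d has_real_derivative
        (deriv (G (c * d + \<mu>)) (c * x + \<mu>) * c - deriv (G d) x)) (at x)"
      if "0 < d" "d < x" for d
    proof -
      have pos: "0 < c * d + \<mu>" "0 < c * x + \<mu>" "c * x + \<mu> \<noteq> c * d + \<mu>"
        using that c by (auto simp: add_pos_nonneg)
      show ?thesis unfolding R_def
        by (rule DERIV_diff[OF DERIV_chain2[where f = "G (c * d + \<mu>)"
              and g = "\<lambda>x. c * x + \<mu>" and x = x, OF D[OF pos]] D])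
           (use that in \<open>auto intro!: derivative_eq_intros\<close>)
    qed
    have "((\<lambda>y. R a y - R b y) has_real_derivative 0) (at x)"
    proof (rule has_field_derivative_transform_within_open)
      show "((\<lambda>_. R a x - R b x) has_real_derivative 0) (at x)" by simp
      show "open {max a b<..}" "x \<in> {max a b<..}" using abx by simp_all
      show "R a x - R b x = R a y - R b y" if "y \<in> {max a b<..}" for y
        by (rule const) (use that in simp)
    qed
    then show ?thesis
      using DERIV_unique[OF DERIV_diff[OF DR[of a] DR[of b]]] abx
      by (simp add: E_def algebra_simps)
  qed
  \<comment> \<open>\<open>E a b x\<close> depends on \<open>u = x - a\<close> and \<open>v = x - b\<close> only; the base point \<open>x = u + v\<close> is a choice
    for which \<open>a = v\<close> and \<open>b = u\<close> are positive.\<close>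
  define e where "e u v = E v u (u + v)" for u v
  have E_shift: "E (x - u) (x - v) x = E (y - u) (y - v) y"
    if "0 < u" "0 < v" "max u v < x" "x \<le> y" for x y u v
    using E_affine[of 1 "y - x" "x - u" "x - v" x] that by (simp add: algebra_simps)
  have E_eq: "E (x - u) (x - v) x = e u v" if "0 < u" "0 < v" "max u v < x" for x u v
    using E_shift[of u v x "u + v"] E_shift[of u v "u + v" x] that
    by (cases "x \<le> u + v") (auto simp: e_def)
  have "\<exists>C. \<forall>u>0. \<forall>v>0. e u v = C * (1 / u - 1 / v)"
  proof (rule homogeneous_cocycle)
    fix u v w :: real assume "0 < u" "0 < v" "0 < w"
    then show "e u v + e v w = e u w"
      using E_eq[of u v "u + v + w"] E_eq[of v w "u + v + w"] E_eq[of u w "u + v + w"]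
      by (simp add: E_def)
  next
    fix c u v :: real assume "0 < c" "0 < u" "0 < v"
    then show "c * e (c * u) (c * v) = e u v"
      using E_affine[of c 0 v u "u + v"] by (simp add: e_def algebra_simps)
  qed
  then obtain \<sigma> where \<sigma>: "\<And>u v. 0 < u \<Longrightarrow> 0 < v \<Longrightarrow> e u v = \<sigma> * (1 / u - 1 / v)" by blast
  have E_val: "E a b x = \<sigma> * (1 / (x - a) - 1 / (x - b))" if "0 < a" "0 < b" "max a b < x" for a b x
    using E_eq[of "x - a" "x - b" x] \<sigma>[of "x - a" "x - b"] that by simp

  \<comment> \<open>Without the logarithmic singularity, \<open>G\<close> splits as \<open>v a + u x\<close> on \<open>a < x\<close>. The absolute value
    makes \<open>M\<close> symmetric, which gives differentiability in the first variable as well.\<close>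
  define M where "M a x = G a x - \<sigma> * ln \<bar>x - a\<bar>" for a x
  have M_sym: "M a x = M x a" if "0 < a" "0 < x" for a x
    using sym[OF that] by (simp add: M_def abs_minus_commute)
  have DM: "(M a has_real_derivative deriv (G a) x - \<sigma> / (x - a)) (at x)"
    if "0 < a" "0 < x" "x \<noteq> a" for a x
  proof -
    have ln_abs: "((\<lambda>y. ln \<bar>y - a\<bar>) has_real_derivative 1 / (x - a)) (at x)"
    proof (cases "a < x")
      case True
      have "((\<lambda>y. ln (y - a)) has_real_derivative 1 / (x - a)) (at x)"
        using True by (auto intro!: derivative_eq_intros)
      then show ?thesis
        by (rule has_field_derivative_transform_within_open[where S = "{a<..}"]) (use True in auto)
    next
      case False
      have "((\<lambda>y. ln (a - y)) has_real_derivative 1 / (x - a)) (at x)"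
        using False that by (auto intro!: derivative_eq_intros simp: field_simps)
      then show ?thesis
        by (rule has_field_derivative_transform_within_open[where S = "{..<a}"])
           (use False that in auto)
    qed
    show ?thesis unfolding M_def
      using DERIV_diff[OF D[OF that] DERIV_cmult[OF ln_abs, of \<sigma>]] by simp
  qed
  have M_diff_const: "M a x - M b x = M a y - M b y"
    if ab: "0 < a" "0 < b" and "max a b < x" "max a b < y" for a b x y
  proof -
    have "((\<lambda>z. M a z - M b z) has_real_derivative 0) (at z within {max a b<..})"
      if "z \<in> {max a b<..}" for z
    proof -
      have "((\<lambda>z. M a z - M b z) has_real_derivative
          (deriv (G a) z - \<sigma> / (z - a)) - (deriv (G b) z - \<sigma> / (z - b))) (at z)"
        by (rule DERIV_diff; rule DM) (use that ab in auto)
      moreover have "(deriv (G a) z - \<sigma> / (z - a)) - (deriv (G b) z - \<sigma> / (z - b)) = 0"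
        using E_val[of a b z] that ab by (simp add: E_def algebra_simps)
      ultimately show ?thesis by (simp add: has_field_derivative_at_within)
    qed
    then obtain k where "\<And>z. z \<in> {max a b<..} \<Longrightarrow> M a z - M b z = k"
      using has_field_derivative_zero_constant[of "{max a b<..}" "\<lambda>z. M a z - M b z"]
      by (auto simp: convex_real_interval)
    then show ?thesis using that by simp
  qed
  \<comment> \<open>\<open>v a\<close> is the constant \<open>M a x - M 1 x\<close>, read off at \<open>x = a + 1 > max a 1\<close>; in the definition of
    \<open>u\<close>, \<open>x / 2\<close> stands for any positive point to the left of \<open>x\<close>.\<close>
  define v where "v a = M a (a + 1) - M 1 (a + 1)" for a
  define u where "u x = M (x / 2) x - v (x / 2)" for x
  have v_eq: "v a = M a x - M 1 x" if "0 < a" "max a 1 < x" for a x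
    using M_diff_const[of a 1 "a + 1" x] that by (simp add: v_def)
  have M_eq: "M a x = v a + u x" if "0 < a" "a < x" for a x
  proof -
    define z where "z = x + 1"
    have "M a x - M (x / 2) x = M a z - M (x / 2) z"
      using M_diff_const[of a "x / 2" x z] that by (simp add: z_def)
    moreover have "v a = M a z - M 1 z" "v (x / 2) = M (x / 2) z - M 1 z"
      using v_eq[of a z] v_eq[of "x / 2" z] that by (auto simp: z_def)
    ultimately show ?thesis by (simp add: u_def)
  qed
  have diff_u: "u differentiable (at x)" if "0 < x" for x
  proof -
    have "((\<lambda>y. M (x / 2) y - v (x / 2)) has_real_derivative
        deriv (G (x / 2)) x - \<sigma> / (x - x / 2)) (at x)"
      using DERIV_diff[OF DM[of "x / 2" x] DERIV_const] that by simp
    then have "(u has_real_derivative deriv (G (x / 2)) x - \<sigma> / (x - x / 2)) (at x)"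
      by (rule has_field_derivative_transform_within_open[where S = "{x / 2<..}"])
         (use that M_eq[of "x / 2"] in auto)
    then show ?thesis using real_differentiable_def by blast
  qed
  have diff_v: "v differentiable (at a)" if "0 < a" for a
  proof -
    define z where "z = a + 1"
    have "((\<lambda>y. M z y - u z) has_real_derivative deriv (G z) a - \<sigma> / (a - z)) (at a)"
      using DERIV_diff[OF DM[of z a] DERIV_const] that by (simp add: z_def)
    then have "(v has_real_derivative deriv (G z) a - \<sigma> / (a - z)) (at a)"
      by (rule has_field_derivative_transform_within_open[where S = "{0<..<z}"])
         (use that M_eq[of _ z] M_sym[of z] in \<open>auto simp: z_def\<close>)
    then show ?thesis using real_differentiable_def by blast
  qed
  \<comment> \<open>In \<open>G a x + G x b\<close> the middle point contributes \<open>u x + v x\<close>, and the logarithms change only by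
    multiples of \<open>ln c\<close>.\<close>
  have quasi_S: "\<exists>K. \<forall>x>0. u (c * x + \<mu>) + v (c * x + \<mu>) = u x + v x + K"
    if c: "0 < c" "0 \<le> \<mu>" for c \<mu>
  proof -
    obtain \<Phi> where \<Phi>: "\<And>a x b. 0 < a \<Longrightarrow> a < x \<Longrightarrow> x < b \<Longrightarrow>
      G (c * a + \<mu>) (c * x + \<mu>) + G (c * x + \<mu>) (c * b + \<mu>) = G a x + G x b + \<Phi> a b"
      using quasi[OF c] by blast
    define S where "S x = u (c * x + \<mu>) + v (c * x + \<mu>) - (u x + v x)" for x
    have G_eq: "G a x = v a + u x + \<sigma> * ln (x - a)" if "0 < a" "a < x" for a x
      using M_eq[OF that] that by (simp add: M_def)
    have G_affine: "G (c * a + \<mu>) (c * x + \<mu>) =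
        v (c * a + \<mu>) + u (c * x + \<mu>) + \<sigma> * (ln c + ln (x - a))" if "0 < a" "a < x" for a x
    proof -
      have "c * x + \<mu> - (c * a + \<mu>) = c * (x - a)" by (simp add: algebra_simps)
      moreover have "0 < c * a + \<mu>" "c * a + \<mu> < c * x + \<mu>"
        using c that by (auto simp: add_pos_nonneg)
      ultimately show ?thesis
        using G_eq[of "c * a + \<mu>" "c * x + \<mu>"] c that by (simp add: ln_mult)
    qed
    have S_eq: "S x = \<Phi> a b - (v (c * a + \<mu>) - v a) - (u (c * b + \<mu>) - u b) - 2 * \<sigma> * ln c"
      if "0 < a" "a < x" "x < b" for a x b
      using \<Phi>[OF that] that G_eq[of a x] G_eq[of x b] G_affine[of a x] G_affine[of x b]
      by (simp add: S_def algebra_simps)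
    have "S x = S 1" if "0 < x" for x
      using S_eq[of "min x 1 / 2" x "max x 1 + 1"] S_eq[of "min x 1 / 2" 1 "max x 1 + 1"] that
      by (simp add: min_def max_def split: if_splits)
    then have "\<forall>x>0. u (c * x + \<mu>) + v (c * x + \<mu>) = u x + v x + S 1"
      by (simp add: S_def algebra_simps)
    then show ?thesis ..
  qed
  have sum_const: "u x + v x = u 1 + v 1" if "0 < x" for x
    by (rule affine_quasi_invariant_imp_constant[of "\<lambda>x. u x + v x" x 1])
       (use diff_u diff_v quasi_S that in auto)
  have "G a x = (u 1 + v 1) + \<sigma> * ln (x - a) + u x - u a" if "0 < a" "a < x" for a x
    using M_eq[OF that] sum_const[of a] that by (simp add: M_def)
  then show ?thesis by blast
qed

section \<open>Power weights and the beta integral\<close>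

text \<open>
  The substitution \<open>x = a + (b - a) * y\<close> maps the unit interval onto the open interval between \<open>a\<close>
  and \<open>b\<close> for either order of the end points. The identity also covers divergent integrals, as
  both sides are then 0.
\<close>
lemma ival_power_integral_scaling:
  fixes a b \<sigma> :: real
  assumes "a \<noteq> b"
  shows "(LINT x:ival a b|lborel. \<bar>b - x\<bar> powr \<sigma> * \<bar>x - a\<bar> powr \<sigma>) =
    \<bar>b - a\<bar> powr (2 * \<sigma> + 1) * (LINT y:{0<..<1}|lborel. y powr \<sigma> * (1 - y) powr \<sigma>)"
proof -
  define h where "h x = indicator (ival a b) x *\<^sub>R (\<bar>b - x\<bar> powr \<sigma> * \<bar>x - a\<bar> powr \<sigma>)" for x
  have h_affine: "h (a + (b - a) * y) = \<bar>b - a\<bar> powr (2 * \<sigma>) *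
      (indicator {0<..<1} y *\<^sub>R (y powr \<sigma> * (1 - y) powr \<sigma>))" for y
  proof -
    have mem: "a + (b - a) * y \<in> ival a b \<longleftrightarrow> y \<in> {0<..<1}"
    proof (cases "a < b")
      case True
      have "a + (b - a) * y < b \<longleftrightarrow> (b - a) * y < (b - a) * 1" by auto
      also have "\<dots> \<longleftrightarrow> y < 1" using True by (subst mult_less_cancel_left_pos) auto
      finally show ?thesis using True by (auto simp: ival_def zero_less_mult_iff)
    next
      case False
      have "b < a + (b - a) * y \<longleftrightarrow> (a - b) * y < (a - b) * 1" by (auto simp: algebra_simps)
      also have "\<dots> \<longleftrightarrow> y < 1" using False assms by (subst mult_less_cancel_left_pos) auto
      finally show ?thesis using False assms by (auto simp: ival_def mult_less_0_iff)
    qed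
    have "\<bar>b - (a + (b - a) * y)\<bar> powr \<sigma> * \<bar>a + (b - a) * y - a\<bar> powr \<sigma> =
        \<bar>b - a\<bar> powr (2 * \<sigma>) * (y powr \<sigma> * (1 - y) powr \<sigma>)" if "y \<in> {0<..<1}"
    proof -
      have "b - (a + (b - a) * y) = (b - a) * (1 - y)" by (simp add: algebra_simps)
      then have "\<bar>b - (a + (b - a) * y)\<bar> = \<bar>b - a\<bar> * (1 - y)"
        using that by (simp add: abs_mult)
      moreover have "\<bar>a + (b - a) * y - a\<bar> = \<bar>b - a\<bar> * y"
        using that by (simp add: abs_mult)
      moreover have "\<bar>b - a\<bar> powr (2 * \<sigma>) = \<bar>b - a\<bar> powr \<sigma> * \<bar>b - a\<bar> powr \<sigma>"
        using powr_add[of "\<bar>b - a\<bar>" \<sigma> \<sigma>] by simp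
      ultimately show ?thesis using that by (simp add: powr_mult)
    qed
    then show ?thesis by (simp add: h_def indicator_def mem del: greaterThanLessThan_iff)
  qed
  have "(LINT x:ival a b|lborel. \<bar>b - x\<bar> powr \<sigma> * \<bar>x - a\<bar> powr \<sigma>) = (\<integral>x. h x \<partial>lborel)"
    by (simp add: set_lebesgue_integral_def h_def)
  also have "\<dots> = \<bar>b - a\<bar> *\<^sub>R (\<integral>y. h (a + (b - a) * y) \<partial>lborel)"
    by (rule lborel_integral_real_affine) (use assms in simp)
  also have "\<dots> = \<bar>b - a\<bar> * (\<bar>b - a\<bar> powr (2 * \<sigma>) *
      (LINT y:{0<..<1}|lborel. y powr \<sigma> * (1 - y) powr \<sigma>))"
    unfolding h_affine set_lebesgue_integral_def by simp
  also have "\<dots> = \<bar>b - a\<bar> powr (2 * \<sigma> + 1) *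
      (LINT y:{0<..<1}|lborel. y powr \<sigma> * (1 - y) powr \<sigma>)"
    using assms by (simp add: powr_add)
  finally show ?thesis .
qed

text \<open>
  For \<open>\<sigma> \<le> -1\<close> the integrand dominates \<open>1 / y\<close>, so it is not integrable near 0, and its Lebesgue
  integral has the default value 0.
\<close>
lemma beta_integral_nonzero_imp_exponent:
  fixes \<sigma> :: real
  assumes "(LINT y:{0<..<1}|lborel. y powr \<sigma> * (1 - y) powr \<sigma>) \<noteq> 0"
  shows "\<sigma> > -1"
proof (rule ccontr)
  assume "\<not> \<sigma> > -1"
  then have \<sigma>: "\<sigma> \<le> -1" by simp
  have "set_integrable lborel {0<..<1} (\<lambda>y. y powr \<sigma> * (1 - y) powr \<sigma>)"
    using assms not_integrable_integral_eq unfolding set_integrable_def set_lebesgue_integral_def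
    by blast
  then have int: "(\<lambda>y. y powr \<sigma> * (1 - y) powr \<sigma>) integrable_on {0<..<1}"
    by (rule set_borel_integral_eq_integral)
  define I where "I = integral {0<..<1} (\<lambda>y. y powr \<sigma> * (1 - y) powr \<sigma>)"
  \<comment> \<open>Chosen such that the integral of \<open>1 / y\<close> from \<open>\<epsilon>\<close> to \<open>1 / 2\<close> is \<open>\<bar>I\<bar> + 1\<close>.\<close>
  define \<epsilon> where "\<epsilon> = exp (- (\<bar>I\<bar> + 1)) / 2"
  have \<epsilon>: "0 < \<epsilon>" "\<epsilon> \<le> 1 / 2" by (auto simp: \<epsilon>_def)
  have ln_int: "((\<lambda>y. 1 / y) has_integral ln (1 / 2) - ln \<epsilon>) {\<epsilon>..1 / 2}"
    using \<epsilon> by (intro fundamental_theorem_of_calculus)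
      (auto intro!: derivative_eq_intros simp flip: has_real_derivative_iff_has_vector_derivative)
  have "ln (1 / 2) - ln \<epsilon> = integral {\<epsilon>..1 / 2} (\<lambda>y. 1 / y)"
    using ln_int by (simp add: integral_unique)
  also have "\<dots> \<le> integral {\<epsilon>..1 / 2} (\<lambda>y. y powr \<sigma> * (1 - y) powr \<sigma>)"
  proof (rule integral_le)
    show "(\<lambda>y. 1 / y) integrable_on {\<epsilon>..1 / 2}" using ln_int by blast
    show "(\<lambda>y. y powr \<sigma> * (1 - y) powr \<sigma>) integrable_on {\<epsilon>..1 / 2}"
      by (rule integrable_on_subinterval[OF int]) (use \<epsilon> in auto)
    fix y assume y: "y \<in> {\<epsilon>..1 / 2}"
    have "y powr -1 \<le> y powr \<sigma>"
      using y \<epsilon> \<sigma> by (intro powr_mono') auto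
    moreover have "(1 - y) powr 0 \<le> (1 - y) powr \<sigma>"
      using y \<epsilon> \<sigma> by (intro powr_mono') auto
    ultimately have "y powr -1 * (1 - y) powr 0 \<le> y powr \<sigma> * (1 - y) powr \<sigma>"
      by (rule mult_mono) auto
    then show "1 / y \<le> y powr \<sigma> * (1 - y) powr \<sigma>"
      using y \<epsilon> by (simp add: powr_neg_one)
  qed
  also have "\<dots> \<le> I"
    unfolding I_def
    by (rule integral_subset_le[OF _ integrable_on_subinterval[OF int] int]) (use \<epsilon> in auto)
  finally have "ln (1 / 2) - ln \<epsilon> \<le> I" .
  moreover have "ln (1 / 2) - ln \<epsilon> = \<bar>I\<bar> + 1"
    by (simp add: \<epsilon>_def ln_div)
  ultimately show False by simp
qed

lemma beta_integral_eq:
  fixes s :: real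
  assumes "s > 0"
  shows "(LINT y:{0<..<1}|lborel. y powr (s - 1) * (1 - y) powr (s - 1)) =
    (Gamma s)\<^sup>2 / Gamma (2 * s)"
proof -
  let ?h = "\<lambda>y::real. y powr (s - 1) * (1 - y) powr (s - 1)"
  have "set_integrable lborel {0<..<1} ?h"
    by (rule set_integrable_subset[OF integrable_Beta[OF assms assms]]) auto
  then have "(LINT y:{0<..<1}|lborel. ?h y) = integral {0<..<1} ?h"
    by (rule set_borel_integral_eq_integral)
  also have "\<dots> = Beta s s"
    using has_integral_Beta_real[OF assms assms]
    by (simp add: has_integral_Icc_iff_Ioo integral_unique)
  finally show ?thesis by (simp add: Beta_def power2_eq_square)
qed

section \<open>The one-site density\<close>

text \<open>
  The factor \<open>t\<close> enters \<open>g b x * g a x\<close> and its integral alike as \<open>t\<^sup>2\<close>, so the constant \<open>f'\<close> can be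
  adjusted to any \<open>t \<noteq> 0\<close>. This gives the kernel both with and without the factor.
\<close>
lemma one_site_form_power:
  assumes \<Lambda>: "\<And>a b x. 0 < a \<Longrightarrow> 0 < b \<Longrightarrow> a \<noteq> b \<Longrightarrow> x \<in> ival a b \<Longrightarrow>
      \<Lambda> 1 a b [x] = \<bar>b - x\<bar> powr \<sigma> * \<bar>x - a\<bar> powr \<sigma> /
        (LINT x:ival a b|lborel. \<bar>b - x\<bar> powr \<sigma> * \<bar>x - a\<bar> powr \<sigma>)"
    and "t \<noteq> 0"
  shows "\<exists>f'. one_site_form \<Lambda> f' (\<lambda>a x. t * \<bar>a - x\<bar> powr \<sigma>)"
proof -
  define N where "N a b = (LINT x:ival a b|lborel. \<bar>b - x\<bar> powr \<sigma> * \<bar>x - a\<bar> powr \<sigma>)" for a b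
  have "(LINT x:ival a b|lborel. t * \<bar>a - x\<bar> powr \<sigma> * (t * \<bar>b - x\<bar> powr \<sigma>)) = t\<^sup>2 * N a b" for a b
  proof -
    have "t * \<bar>a - x\<bar> powr \<sigma> * (t * \<bar>b - x\<bar> powr \<sigma>) =
        t\<^sup>2 * (\<bar>b - x\<bar> powr \<sigma> * \<bar>x - a\<bar> powr \<sigma>)" for x
      by (simp add: power2_eq_square abs_minus_commute)
    then show ?thesis unfolding N_def by (simp only: set_integral_mult_right)
  qed
  moreover have "\<Lambda> 1 a b [x] =
      inverse (t\<^sup>2 * N a b) * (t * \<bar>b - x\<bar> powr \<sigma>) * (t * \<bar>a - x\<bar> powr \<sigma>)"
    if "0 < a" "0 < b" "a \<noteq> b" "x \<in> ival a b" for a b x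
    using \<Lambda>[OF that, folded N_def] \<open>t \<noteq> 0\<close>
    by (simp add: power2_eq_square abs_minus_commute field_simps)
  ultimately have "one_site_form \<Lambda> (\<lambda>a b. inverse (t\<^sup>2 * N a b)) (\<lambda>a x. t * \<bar>a - x\<bar> powr \<sigma>)"
    unfolding one_site_form_def by simp
  then show ?thesis by blast
qed

lemma one_site_nonzero:
  assumes "two_sided_markov \<Lambda>" "0 < a" "0 < b" "a \<noteq> b" "x \<in> ival a b"
  shows "\<Lambda> 1 a b [x] \<noteq> 0"
proof -
  have "supp (\<lambda>x. \<Lambda> 1 a b [x]) = ival a b"
    using assms(1-4) by (simp add: two_sided_markov_def)
  then show ?thesis using assms(5) by (auto simp: supp_def)
qed

lemma one_site_form_value:
  assumes "one_site_form \<Lambda> f g" "0 < a" "0 < b" "a \<noteq> b" "x \<in> ival a b"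
  shows "\<Lambda> 1 a b [x] = f a b * g b x * g a x"
  using assms by (simp add: one_site_form_def)

lemma one_site_form_normalizer:
  assumes "one_site_form \<Lambda> f g" "0 < a" "0 < b" "a \<noteq> b"
  shows "inverse (f a b) = (LINT x:ival a b|lborel. g a x * g b x)"
  using assms by (simp add: one_site_form_def)

lemma kernel_pos:
  assumes "two_sided_markov \<Lambda>" "one_site_form \<Lambda> f g"
    and nonneg: "\<And>u v. 0 \<le> u \<Longrightarrow> 0 \<le> v \<Longrightarrow> 0 \<le> g u v"
    and ax: "0 < a" "0 < x" "a \<noteq> x"
  shows "0 < g a x"
proof -
  \<comment> \<open>A positive point such that \<open>x\<close> lies between \<open>a\<close> and \<open>b\<close>.\<close>
  define b where "b = (if a < x then x + 1 else x / 2)"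
  have "0 < b" "a \<noteq> b" "x \<in> ival a b" using ax by (auto simp: b_def ival_def)
  then have "g a x \<noteq> 0"
    using one_site_form_value[OF assms(2), of a b x] one_site_nonzero[OF assms(1), of a b x] ax
    by auto
  then show ?thesis using nonneg[of a x] ax by simp
qed

lemma normalizer_pos:
  assumes "two_sided_markov \<Lambda>" and form: "one_site_form \<Lambda> f g"
    and nonneg: "\<And>u v. 0 \<le> u \<Longrightarrow> 0 \<le> v \<Longrightarrow> 0 \<le> g u v"
    and ab: "0 < a" "0 < b" "a \<noteq> b"
  shows "0 < f a b"
proof -
  have mid: "(a + b) / 2 \<in> ival a b" using ab by (auto simp: ival_def min_def max_def)
  have "0 < x" if "x \<in> ival a b" for x using that ab by (auto simp: ival_def min_def split: if_splits)
  then have "0 \<le> indicator (ival a b) x *\<^sub>R (g a x * g b x)" for x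
    using nonneg[of a x] nonneg[of b x] ab by (auto simp: indicator_def less_imp_le)
  then have "0 \<le> (LINT x:ival a b|lborel. g a x * g b x)"
    unfolding set_lebesgue_integral_def by (rule Bochner_Integration.integral_nonneg)
  then have "0 \<le> f a b"
    using one_site_form_normalizer[OF form ab] by (metis inverse_nonnegative_iff_nonnegative)
  moreover have "f a b \<noteq> 0"
    using one_site_form_value[OF form ab mid] one_site_nonzero[OF assms(1) ab mid] by auto
  ultimately show ?thesis by simp
qed

lemma one_site_affine_invariant:
  assumes "scale_invariant \<Lambda>" "shift_invariant \<Lambda>"
    and c: "0 < c" "0 \<le> \<mu>" and ab: "0 < a" "0 < b" "a \<noteq> b" and x: "x \<in> ival a b"
  shows "\<Lambda> 1 a b [x] = c * \<Lambda> 1 (c * a + \<mu>) (c * b + \<mu>) [c * x + \<mu>]"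
proof -
  have "\<Lambda> 1 a b [x] = c * \<Lambda> 1 (c * a) (c * b) [c * x]"
    using assms(1)[unfolded scale_invariant_def, rule_format, of 1 a b c "[x]"] c ab x by simp
  also have "\<Lambda> 1 (c * a) (c * b) [c * x] = \<Lambda> 1 (c * a + \<mu>) (c * b + \<mu>) [c * x + \<mu>]"
  proof -
    have "c * x \<in> ival (c * a) (c * b)"
      using x c by (auto simp: ival_def min_def max_def split: if_splits)
    moreover have "0 < c * a" "0 < c * b" using c ab by simp_all
    moreover from this have "- min (c * a) (c * b) < \<mu>" using c by (simp add: min_def)
    ultimately show ?thesis
      using assms(2)[unfolded shift_invariant_def, rule_format,
          of 1 "c * a" "c * b" \<mu> "[c * x]"] c ab by simp
  qed
  finally show ?thesis .
qed

text \<open>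
  The logarithm of the invariance of \<open>f a b * g b x * g a x\<close> is quasi-invariance of \<open>ln (g a x)\<close>,
  with the logarithms of \<open>c\<close> and of the normalizing constants in the role of \<open>\<Phi>\<close>.
\<close>
lemma log_kernel_quasi_invariant:
  assumes markov: "two_sided_markov \<Lambda>" and form: "one_site_form \<Lambda> f g"
    and inv: "scale_invariant \<Lambda>" "shift_invariant \<Lambda>"
    and nonneg: "\<And>u v. 0 \<le> u \<Longrightarrow> 0 \<le> v \<Longrightarrow> 0 \<le> g u v"
    and sym: "\<And>u v. 0 \<le> u \<Longrightarrow> 0 \<le> v \<Longrightarrow> g u v = g v u"
    and c: "0 < c" "0 \<le> \<mu>" and axb: "0 < a" "a < x" "x < b"
  shows "ln (g (c * a + \<mu>) (c * x + \<mu>)) + ln (g (c * x + \<mu>) (c * b + \<mu>)) =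
    ln (g a x) + ln (g x b) + (ln (f a b) - ln (f (c * a + \<mu>) (c * b + \<mu>)) - ln c)"
proof -
  have g_pos: "0 < g a x" if "0 < a" "0 < x" "a \<noteq> x" for a x
    by (rule kernel_pos[OF markov form nonneg that])
  have f_pos: "0 < f a b" if "0 < a" "0 < b" "a \<noteq> b" for a b
    by (rule normalizer_pos[OF markov form nonneg that])
  define a' x' b' where "a' = c * a + \<mu>" and "x' = c * x + \<mu>" and "b' = c * b + \<mu>"
  have ord: "0 < a'" "a' < x'" "x' < b'"
    using c axb by (auto simp: a'_def x'_def b'_def add_pos_nonneg)
  have mem: "x \<in> ival a b" "x' \<in> ival a' b'" using axb ord by (auto simp: ival_def)
  have "\<Lambda> 1 a b [x] = c * \<Lambda> 1 a' b' [x']"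
    unfolding a'_def x'_def b'_def
    by (rule one_site_affine_invariant[OF inv c]) (use axb mem in auto)
  moreover have "\<Lambda> 1 a b [x] = f a b * g b x * g a x"
    by (rule one_site_form_value[OF form]) (use axb mem in auto)
  moreover have "\<Lambda> 1 a' b' [x'] = f a' b' * g b' x' * g a' x'"
    by (rule one_site_form_value[OF form]) (use ord mem in auto)
  ultimately have "ln (f a b * g b x * g a x) = ln (c * (f a' b' * g b' x' * g a' x'))" by simp
  moreover have "0 < f a b" "0 < f a' b'" using f_pos axb ord by auto
  moreover have "0 < g b x" "0 < g a x" "0 < g b' x'" "0 < g a' x'" using g_pos axb ord by auto
  ultimately have "ln (f a b) + ln (g b x) + ln (g a x) =
      ln c + (ln (f a' b') + ln (g b' x') + ln (g a' x'))"
    using c by (simp add: ln_mult_pos)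
  moreover have "g b x = g x b" "g b' x' = g x' b'" using sym axb ord by auto
  ultimately show ?thesis by (simp flip: a'_def x'_def b'_def)
qed

lemma affine_invariant_kernel_form:
  assumes markov: "two_sided_markov \<Lambda>" and form: "one_site_form \<Lambda> f g"
    and inv: "scale_invariant \<Lambda>" "shift_invariant \<Lambda>"
    and nonneg: "\<And>u v. 0 \<le> u \<Longrightarrow> 0 \<le> v \<Longrightarrow> 0 \<le> g u v"
    and sym: "\<And>u v. 0 \<le> u \<Longrightarrow> 0 \<le> v \<Longrightarrow> g u v = g v u"
    and diff: "\<And>x y. 0 < x \<Longrightarrow> 0 < y \<Longrightarrow> y \<noteq> x \<Longrightarrow> g x differentiable (at y)"
  shows "\<exists>\<sigma> t p. 0 < t \<and> (\<forall>u. 0 < p u) \<and> (\<forall>a>0. \<forall>x>0. a \<noteq> x \<longrightarrow>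
    g a x = t * \<bar>a - x\<bar> powr \<sigma> * (p (min a x) / p (max a x)))"
proof -
  have g_pos: "0 < g a x" if "0 < a" "0 < x" "a \<noteq> x" for a x
    by (rule kernel_pos[OF markov form nonneg that])
  define G where "G a x = ln (g a x)" for a x
  have "\<exists>\<sigma> K u. \<forall>a x. 0 < a \<longrightarrow> a < x \<longrightarrow> G a x = K + \<sigma> * ln (x - a) + u x - u a"
  proof (rule affine_quasi_invariant_kernel)
    show "G a x = G x a" if "0 < a" "0 < x" for a x
      using sym[of a x] that by (simp add: G_def)
    show "G a differentiable (at x)" if "0 < a" "0 < x" "x \<noteq> a" for a x
    proof -
      have "g a differentiable (at x)" by (rule diff[OF that])
      then obtain D where "(g a has_real_derivative D) (at x)"
        using real_differentiable_def by blast
      moreover have "0 < g a x" using g_pos[of a x] that by simp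
      ultimately have "((\<lambda>x. ln (g a x)) has_real_derivative 1 / g a x * D) (at x)"
        by (auto intro!: derivative_eq_intros)
      then have "(G a has_real_derivative 1 / g a x * D) (at x)"
        by (simp add: G_def[abs_def])
      then show ?thesis using real_differentiable_def by blast
    qed
    show "\<exists>\<Phi>. \<forall>a x b. 0 < a \<longrightarrow> a < x \<longrightarrow> x < b \<longrightarrow>
        G (c * a + \<mu>) (c * x + \<mu>) + G (c * x + \<mu>) (c * b + \<mu>) = G a x + G x b + \<Phi> a b"
      if "0 < c" "0 \<le> \<mu>" for c \<mu>
      unfolding G_def
      by (intro exI[of _ "\<lambda>a b. ln (f a b) - ln (f (c * a + \<mu>) (c * b + \<mu>)) - ln c"] allI impI
          log_kernel_quasi_invariant[OF markov form inv nonneg sym that])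
  qed
  then obtain \<sigma> K u where G_eq:
    "\<And>a x. 0 < a \<Longrightarrow> a < x \<Longrightarrow> G a x = K + \<sigma> * ln (x - a) + u x - u a" by blast
  define t where "t = exp K"
  define p where "p x = exp (- u x)" for x
  have g_less: "g a x = t * \<bar>a - x\<bar> powr \<sigma> * (p a / p x)" if "0 < a" "a < x" for a x
  proof -
    have "g a x = exp (G a x)" using g_pos[of a x] that by (simp add: G_def)
    also have "\<dots> = exp K * exp (\<sigma> * ln (x - a)) * (exp (- u a) / exp (- u x))"
      unfolding G_eq[OF that] by (simp flip: exp_add exp_diff)
    finally show ?thesis using that by (simp add: t_def p_def powr_def abs_minus_commute)
  qed
  have "\<forall>a>0. \<forall>x>0. a \<noteq> x \<longrightarrow> g a x = t * \<bar>a - x\<bar> powr \<sigma> * (p (min a x) / p (max a x))"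
  proof (intro allI impI)
    fix a x :: real assume ax: "0 < a" "0 < x" "a \<noteq> x"
    show "g a x = t * \<bar>a - x\<bar> powr \<sigma> * (p (min a x) / p (max a x))"
      using g_less[of a x] g_less[of x a] sym[of a x] ax
      by (cases "a < x") (auto simp: abs_minus_commute)
  qed
  moreover have "0 < t" "\<forall>u. 0 < p u" by (simp_all add: t_def p_def)
  ultimately show ?thesis by (intro exI[of _ \<sigma>] exI[of _ t] exI[of _ p] conjI)
qed

text \<open>
  In \<open>g a x * g b x\<close> the values of \<open>p\<close> at the middle point cancel. What remains of \<open>p\<close> is constant
  in \<open>x\<close>, and cancels against the normalization.
\<close>
lemma one_site_power_density:
  assumes form: "one_site_form \<Lambda> f g" and "0 < t" and p: "\<And>u. 0 < p u"
    and g: "\<And>a x. 0 < a \<Longrightarrow> 0 < x \<Longrightarrow> a \<noteq> x \<Longrightarrow>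
      g a x = t * \<bar>a - x\<bar> powr \<sigma> * (p (min a x) / p (max a x))"
    and ab: "0 < a" "0 < b" "a \<noteq> b" and x: "x \<in> ival a b"
  shows "\<Lambda> 1 a b [x] = \<bar>b - x\<bar> powr \<sigma> * \<bar>x - a\<bar> powr \<sigma> /
    (LINT x:ival a b|lborel. \<bar>b - x\<bar> powr \<sigma> * \<bar>x - a\<bar> powr \<sigma>)"
proof -
  define N where "N = (LINT x:ival a b|lborel. \<bar>b - x\<bar> powr \<sigma> * \<bar>x - a\<bar> powr \<sigma>)"
  define q where "q = t\<^sup>2 * (p (min a b) / p (max a b))"
  have "0 < q" using \<open>0 < t\<close> p by (simp add: q_def)
  have gg: "g a y * g b y = q * (\<bar>b - y\<bar> powr \<sigma> * \<bar>y - a\<bar> powr \<sigma>)" if "y \<in> ival a b" for y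
  proof -
    have y: "0 < y" "a \<noteq> y" "b \<noteq> y"
      using that ab by (auto simp: ival_def min_def max_def split: if_splits)
    have "g a y * g b y = t\<^sup>2 * (p (min a y) / p (max a y) * (p (min b y) / p (max b y))) *
        (\<bar>b - y\<bar> powr \<sigma> * \<bar>y - a\<bar> powr \<sigma>)"
      unfolding g[OF ab(1) y(1,2)] g[OF ab(2) y(1,3)]
      by (simp only: power2_eq_square abs_minus_commute mult_ac)
    moreover have "p (min a y) / p (max a y) * (p (min b y) / p (max b y)) =
        p (min a b) / p (max a b)"
      using that p[of y] by (cases "a < b") (auto simp: ival_def min_def max_def)
    ultimately show ?thesis by (simp only: q_def)
  qed
  have "inverse (f a b) = (LINT x:ival a b|lborel. q * (\<bar>b - x\<bar> powr \<sigma> * \<bar>x - a\<bar> powr \<sigma>))"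
    unfolding one_site_form_normalizer[OF form ab]
    by (rule set_lebesgue_integral_cong) (use gg in \<open>auto simp: ival_def\<close>)
  then have "f a b = inverse (q * N)"
    unfolding N_def set_integral_mult_right by (metis inverse_inverse_eq)
  then have "\<Lambda> 1 a b [x] = inverse (q * N) * (q * (\<bar>b - x\<bar> powr \<sigma> * \<bar>x - a\<bar> powr \<sigma>))"
    using one_site_form_value[OF form ab x] gg[OF x] by (simp add: mult_ac)
  then show ?thesis unfolding N_def[symmetric] using \<open>0 < q\<close> by (simp add: field_simps)
qed

lemma one_site_ordered_dirichlet:
  assumes "s > 0" "a \<noteq> b" "x \<in> ival a b"
  shows "\<bar>b - x\<bar> powr (s - 1) * \<bar>x - a\<bar> powr (s - 1) /
      (LINT x:ival a b|lborel. \<bar>b - x\<bar> powr (s - 1) * \<bar>x - a\<bar> powr (s - 1)) =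
    ordered_dirichlet_density s a b x"
proof -
  have "2 * (s - 1) + 1 = 2 * s - 1" by simp
  moreover have "\<bar>b - a\<bar> powr (- (2 * s - 1)) = inverse (\<bar>b - a\<bar> powr (2 * s - 1))"
    by (rule powr_minus)
  ultimately show ?thesis
    unfolding ordered_dirichlet_density_def ival_power_integral_scaling[OF assms(2)]
      beta_integral_eq[OF assms(1)]
    using assms(3) by (simp only: divide_inverse inverse_mult_distrib inverse_inverse_eq
        indicator_simps mult_1_right ac_simps)
qed

theorem theorem5p3:
  fixes \<Lambda> :: family and f g :: "real \<Rightarrow> real \<Rightarrow> real"
  assumes "density_family \<Lambda>"
    and "symmetric_family \<Lambda>"
    and "two_sided_markov \<Lambda>"
    and g_nonneg: "\<And>u v. 0 \<le> u \<Longrightarrow> 0 \<le> v \<Longrightarrow> 0 \<le> g u v"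
    and g_sym: "\<And>u v. 0 \<le> u \<Longrightarrow> 0 \<le> v \<Longrightarrow> g u v = g v u"
    and g_diff: "\<And>x y. 0 < x \<Longrightarrow> 0 < y \<Longrightarrow> y \<noteq> x \<Longrightarrow> g x differentiable (at y)"
    and form: "one_site_form \<Lambda> f g"
    and "scale_invariant \<Lambda>"
    and "shift_invariant \<Lambda>"
  shows "\<exists>\<sigma> t s :: real. \<sigma> > -1 \<and> t > 0 \<and> s = \<sigma> + 1 \<and>
    (\<exists>p. (\<forall>u>0. p u > 0) \<and>
      (\<forall>a>0. \<forall>x>0. a \<noteq> x \<longrightarrow>
        g a x = t * \<bar>a - x\<bar> powr \<sigma> * (p (min a x) / p (max a x)))) \<and>
    (\<exists>f'. one_site_form \<Lambda> f' (\<lambda>a x. t * \<bar>a - x\<bar> powr \<sigma>)) \<and>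
    (\<exists>f'. one_site_form \<Lambda> f' (\<lambda>a x. \<bar>a - x\<bar> powr (s - 1))) \<and>
    (\<forall>a>0. \<forall>b>0. a \<noteq> b \<longrightarrow>
      (\<forall>x. \<Lambda> 1 a b [x] = ordered_dirichlet_density s a b x))"
proof -
  have "\<exists>\<sigma> t p. 0 < t \<and> (\<forall>u. 0 < p u) \<and> (\<forall>a>0. \<forall>x>0. a \<noteq> x \<longrightarrow>
      g a x = t * \<bar>a - x\<bar> powr \<sigma> * (p (min a x) / p (max a x)))"
    by (rule affine_invariant_kernel_form[OF assms(3) form assms(8,9) g_nonneg g_sym g_diff])
  then obtain \<sigma> t p where "0 < t" and p: "\<forall>u. 0 < p u"
    and g_eq: "\<forall>a>0. \<forall>x>0. a \<noteq> x \<longrightarrow>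
      g a x = t * \<bar>a - x\<bar> powr \<sigma> * (p (min a x) / p (max a x))"
    by (elim exE conjE) (rule that)
  have density: "\<Lambda> 1 a b [x] = \<bar>b - x\<bar> powr \<sigma> * \<bar>x - a\<bar> powr \<sigma> /
      (LINT x:ival a b|lborel. \<bar>b - x\<bar> powr \<sigma> * \<bar>x - a\<bar> powr \<sigma>)"
    if "0 < a" "0 < b" "a \<noteq> b" "x \<in> ival a b" for a b x
    by (rule one_site_power_density[where p = p, OF form \<open>0 < t\<close> _ _ that]) (use p g_eq in blast)+
  have forms: "\<exists>f'. one_site_form \<Lambda> f' (\<lambda>a x. r * \<bar>a - x\<bar> powr \<sigma>)" if "r \<noteq> 0" for r
    using density that by (rule one_site_form_power)
  have "\<sigma> > -1"
  proof (rule beta_integral_nonzero_imp_exponent)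
    \<comment> \<open>If the integral were 0, so would be the quotient \<open>density\<close>, as division by 0 gives 0.\<close>
    have mid: "3 / 2 \<in> ival 1 (2 :: real)" by (simp add: ival_def)
    show "(LINT y:{0<..<1}|lborel. y powr \<sigma> * (1 - y) powr \<sigma>) \<noteq> 0"
      using density[OF _ _ _ mid] one_site_nonzero[OF assms(3) _ _ _ mid]
        ival_power_integral_scaling[of 1 2 \<sigma>] by auto
  qed
  have dirichlet: "\<Lambda> 1 a b [x] = ordered_dirichlet_density (\<sigma> + 1) a b x"
    if ab: "0 < a" "0 < b" "a \<noteq> b" for a b x
  proof (cases "x \<in> ival a b")
    case True
    then show ?thesis
      using density[OF ab True] one_site_ordered_dirichlet[of "\<sigma> + 1" a b x] ab \<open>\<sigma> > -1\<close> by simp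
  next
    case False
    have "\<forall>\<theta>. length \<theta> = 1 \<longrightarrow> \<not> set \<theta> \<subseteq> ival a b \<longrightarrow> \<Lambda> 1 a b \<theta> = 0"
      using \<open>density_family \<Lambda>\<close> ab unfolding density_family_def by blast
    then show ?thesis using False by (simp add: ordered_dirichlet_density_def)
  qed
  show ?thesis
  proof (rule exI[of _ \<sigma>], rule exI[of _ t], rule exI[of _ "\<sigma> + 1"], intro conjI)
    show "\<exists>p. (\<forall>u>0. p u > 0) \<and> (\<forall>a>0. \<forall>x>0. a \<noteq> x \<longrightarrow>
        g a x = t * \<bar>a - x\<bar> powr \<sigma> * (p (min a x) / p (max a x)))"
      using p g_eq by blast
    show "\<exists>f'. one_site_form \<Lambda> f' (\<lambda>a x. t * \<bar>a - x\<bar> powr \<sigma>)"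
      using forms[of t] \<open>0 < t\<close> by simp
    show "\<exists>f'. one_site_form \<Lambda> f' (\<lambda>a x. \<bar>a - x\<bar> powr (\<sigma> + 1 - 1))"
      using forms[of 1] by simp
    show "\<forall>a>0. \<forall>b>0. a \<noteq> b \<longrightarrow>
        (\<forall>x. \<Lambda> 1 a b [x] = ordered_dirichlet_density (\<sigma> + 1) a b x)"
      using dirichlet by blast
  qed (use \<open>\<sigma> > -1\<close> \<open>0 < t\<close> in simp_all)
qed

end
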